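(* Let $(z,w)$ be the standard complex coordinates on $\mathbb{C}^2$, write $u=\operatorname{Re}(w)$, and let $g$ be the Kähler metric on $\mathbb{C}^2$ with potential $f(z,w)=4|z|^2e^{\operatorname{Re}(w)}+e^{-\operatorname{Re}(w)}$, i.e. the metric whose coefficient matrix is $$g=\begin{pmatrix}\frac{\partial^2 f}{\partial z\partial\bar z} & \frac{\partial^2 f}{\partial z\partial\bar w}\\[0.5em] \frac{\partial^2 f}{\partial w\partial\bar z} & \frac{\partial^2 f}{\partial w\partial\bar w}\end{pmatrix}=\begin{pmatrix}4e^u & 2\bar z e^u\\[0.5em] 2ze^u & |z|^2e^u+\frac14 e^{-u}\end{pmatrix}.$$ Then $g$ is flat, i.e. its curvature tensor vanishes identically on $\mathbb{C}^2$.
   Context: The metric $g$ is called Warren's metric. Derivatives are Wirtinger derivatives. The curvature tensor is that of the Levi-Civita connection of the Kähler metric $g$ (which for a Kähler metric coincides with the Chern connection). In holomorphic coordinates $(z_1,\dots,z_n)$ the Christoffel symbols of a Kähler metric are $\Gamma^{\alpha}_{\beta\gamma}=\sum_\nu \frac{\partial g_{\gamma\bar\nu}}{\partial z_\beta}g^{\bar\nu\alpha}$, where $(g^{\bar\nu\alpha})$ is the inverse matrix of $(g_{\alpha\bar\nu})$, and the only possibly non-zero curvature coefficients are $R^{\delta}_{\alpha\bar\beta\gamma}=-\frac{\partial\Gamma^\delta_{\alpha\gamma}}{\partial\bar z_\beta}$, $R^{\delta}_{\bar\alpha\beta\gamma}=\frac{\partial\Gamma^\delta_{\beta\gamma}}{\partial\bar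 z_\alpha}$ and their conjugates. *)

theory Defs
  imports "HOL-Analysis.Analysis"
begin

text \<open>
  Wirtinger derivatives on \<open>\<complex>\<^sup>n\<close>; the Frechet derivative is the real one,
  so no holomorphy is involved.
\<close>

definition wirtinger ::
  "'n::finite \<Rightarrow> (complex^'n \<Rightarrow> complex) \<Rightarrow> complex^'n \<Rightarrow> complex" where
  "wirtinger j F p =
     (frechet_derivative F (at p) (axis j 1) - \<i> * frechet_derivative F (at p) (axis j \<i>)) / 2"

definition wirtinger_bar ::
  "'n::finite \<Rightarrow> (complex^'n \<Rightarrow> complex) \<Rightarrow> complex^'n \<Rightarrow> complex" where
  "wirtinger_bar j F p =
     (frechet_derivative F (at p) (axis j 1) + \<i> * frechet_derivative F (at p) (axis j \<i>)) / 2"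

text \<open>\<open>C_k k F\<close>: all iterated directional derivatives of order up to \<open>k\<close> exist and are continuous.\<close>

primrec C_k :: "nat \<Rightarrow> ('a::real_normed_vector \<Rightarrow> 'b::real_normed_vector) \<Rightarrow> bool" where
  "C_k 0 F \<longleftrightarrow> continuous_on UNIV F"
| "C_k (Suc k) F \<longleftrightarrow>
     (\<forall>x. F differentiable (at x)) \<and> (\<forall>v. C_k k (\<lambda>x. frechet_derivative F (at x) v))"

definition smooth :: "('a::real_normed_vector \<Rightarrow> 'b::real_normed_vector) \<Rightarrow> bool" where
  "smooth F \<longleftrightarrow> (\<forall>k. C_k k F)"

text \<open>
  A metric on \<open>\<complex>\<^sup>n\<close> is given by its coefficient matrix: \<open>g p $ a $ b\<close> is the coefficient with
  holomorphic index \<open>a\<close> and antiholomorphic index \<open>b\<close>. The last condition of the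
  definition is the closedness of the associated (1,1)-form; the conjugate equations follow
  since the matrix is Hermitian.
\<close>

definition kahler_metric :: "(complex^'n::finite \<Rightarrow> complex^'n^'n) \<Rightarrow> bool" where
  "kahler_metric g \<longleftrightarrow>
     (\<forall>a b. smooth (\<lambda>p. g p $ a $ b)) \<and>
     (\<forall>p a b. g p $ b $ a = cnj (g p $ a $ b)) \<and>
     (\<forall>p v. v \<noteq> 0 \<longrightarrow> 0 < Re (\<Sum>a\<in>UNIV. \<Sum>b\<in>UNIV. g p $ a $ b * v $ a * cnj (v $ b))) \<and>
     (\<forall>p a b c. wirtinger a (\<lambda>q. g q $ b $ c) p = wirtinger b (\<lambda>q. g q $ a $ c) p)"

definition potential_metric ::
  "(complex^'n::finite \<Rightarrow> real) \<Rightarrow> complex^'n \<Rightarrow> complex^'n^'n" where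
  "potential_metric f p =
     (\<chi> a b. wirtinger a (wirtinger_bar b (\<lambda>q. complex_of_real (f q))) p)"

text \<open>
  The complexified tangent bundle has the frame \<open>\<partial>/\<partial>z\<^sub>a\<close> (index \<open>Inl a\<close>) and
  \<open>\<partial>/\<partial>z\<^sub>a\<close>-bar (index \<open>Inr a\<close>). In it the complex bilinear extension of the
  Riemannian metric has the following matrix, up to a constant factor that affects neither the
  Christoffel symbols nor the curvature coefficients below.
\<close>

fun frame_deriv ::
  "'n::finite + 'n \<Rightarrow> (complex^'n \<Rightarrow> complex) \<Rightarrow> complex^'n \<Rightarrow> complex" where
  "frame_deriv (Inl a) = wirtinger a"
| "frame_deriv (Inr a) = wirtinger_bar a"

fun frame_coeff :: "complex^'n^'n \<Rightarrow> 'n::finite + 'n \<Rightarrow> 'n + 'n \<Rightarrow> complex" where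
  "frame_coeff h (Inl a) (Inr b) = h $ a $ b"
| "frame_coeff h (Inr b) (Inl a) = h $ a $ b"
| "frame_coeff h (Inl a) (Inl b) = 0"
| "frame_coeff h (Inr a) (Inr b) = 0"

definition frame_matrix :: "complex^'n^'n \<Rightarrow> complex^('n::finite + 'n)^('n + 'n)" where
  "frame_matrix h = (\<chi> A B. frame_coeff h A B)"

text \<open>
  \<open>christoffel g D A B\<close> is the coefficient \<open>\<Gamma>\<close> with upper index \<open>D\<close> and lower indices
  \<open>A B\<close> of the Levi-Civita connection (Koszul formula in a frame of commuting fields). For a Kaehler
  metric with all indices holomorphic, it reduces to the sum over \<open>c\<close> of
  \<open>wirtinger a (\<lambda>q. g q $ b $ c) p * matrix_inv (g p) $ c $ d\<close>, the symbols with all indices antiholomorphic are the conjugates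
  of these, and the mixed ones vanish.
\<close>

definition christoffel ::
  "(complex^'n::finite \<Rightarrow> complex^'n^'n) \<Rightarrow> 'n + 'n \<Rightarrow> 'n + 'n \<Rightarrow> 'n + 'n \<Rightarrow> complex^'n \<Rightarrow> complex" where
  "christoffel g D A B p =
     (\<Sum>E\<in>UNIV. (frame_deriv A (\<lambda>q. frame_coeff (g q) B E) p
               + frame_deriv B (\<lambda>q. frame_coeff (g q) A E) p
               - frame_deriv E (\<lambda>q. frame_coeff (g q) A B) p)
              * matrix_inv (frame_matrix (g p)) $ E $ D) / 2"

text \<open>
  Sign and index convention: \<open>R(\<partial>\<^sub>A, \<partial>\<^sub>B) \<partial>\<^sub>C\<close> is the sum over \<open>D\<close> of
  \<open>curvature g D A B C\<close> times \<open>\<partial>\<^sub>D\<close>. All types of indices are included, in particular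
  the coefficients of type \<open>D = Inl d, A = Inl a, B = Inr b, C = Inl c\<close>, which for a Kaehler
  metric equal \<open>- wirtinger_bar b (christoffel g (Inl d) (Inl a) (Inl c))\<close>.
\<close>

definition curvature ::
  "(complex^'n::finite \<Rightarrow> complex^'n^'n) \<Rightarrow>
     'n + 'n \<Rightarrow> 'n + 'n \<Rightarrow> 'n + 'n \<Rightarrow> 'n + 'n \<Rightarrow> complex^'n \<Rightarrow> complex" where
  "curvature g D A B C p =
     frame_deriv A (christoffel g D B C) p - frame_deriv B (christoffel g D A C) p
     + (\<Sum>E\<in>UNIV. christoffel g E B C p * christoffel g D A E p
                - christoffel g E A C p * christoffel g D B E p)"

definition flat_metric :: "(complex^'n::finite \<Rightarrow> complex^'n^'n) \<Rightarrow> bool" where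
  "flat_metric g \<longleftrightarrow> (\<forall>A B C D p. curvature g D A B C p = 0)"

end

theory Submission
  imports Defs
begin

text \<open>
  The metric has determinant 1, so its inverse is its adjugate, and in the Christoffel symbols all
  exponentials cancel: up to symmetry and conjugation the only nonzero ones are the holomorphic
  functions \<open>\<Gamma>\<close> with upper index \<open>z\<close> and lower indices \<open>zw\<close>, equal to \<open>1/2\<close>, with upper index \<open>z\<close>
  and lower indices \<open>ww\<close>, equal to \<open>z/2\<close>, and with upper index \<open>w\<close> and lower indices \<open>ww\<close>, equal to
  \<open>-1/2\<close>. Since they are holomorphic, the curvature coefficients of mixed type vanish; those
  of pure type are seen to vanish by substitution.
\<close>

section \<open>Wirtinger calculus\<close>

text \<open>Uniqueness of the Frechet derivative lets any known derivative stand in for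
  \<open>frechet_derivative\<close>.\<close>

lemma wirtinger_eq:
  assumes "(F has_derivative F') (at p)"
  shows "wirtinger j F p = (F' (axis j 1) - \<i> * F' (axis j \<i>)) / 2"
    and "wirtinger_bar j F p = (F' (axis j 1) + \<i> * F' (axis j \<i>)) / 2"
  using frechet_derivative_at[OF assms] by (simp_all add: wirtinger_def wirtinger_bar_def)

lemma frame_deriv_const [simp]: "frame_deriv A (\<lambda>q. c) p = 0"
  by (cases A) (simp_all add: wirtinger_def wirtinger_bar_def)

text \<open>Both Wirtinger operators are complex combinations of real directional derivatives, so
  real differentiability suffices and one rule for \<open>frame_deriv\<close> serves both types of
  index.\<close>

lemma
  assumes "F differentiable at p" "G differentiable at p"
  shows frame_deriv_add: "frame_deriv A (\<lambda>q. F q + G q) p = frame_deriv A F p + frame_deriv A G p"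
    and frame_deriv_mult:
      "frame_deriv A (\<lambda>q. F q * G q) p = frame_deriv A F p * G p + F p * frame_deriv A G p"
proof -
  obtain F' G' where d: "(F has_derivative F') (at p)" "(G has_derivative G') (at p)"
    using assms by (auto simp: differentiable_def)
  note eqs = wirtinger_eq[OF has_derivative_add[OF d]] wirtinger_eq[OF has_derivative_mult[OF d]]
    wirtinger_eq[OF d(1)] wirtinger_eq[OF d(2)]
  show "frame_deriv A (\<lambda>q. F q + G q) p = frame_deriv A F p + frame_deriv A G p"
    by (cases A) (simp_all add: eqs field_simps)
  show "frame_deriv A (\<lambda>q. F q * G q) p = frame_deriv A F p * G p + F p * frame_deriv A G p"
    by (cases A) (simp_all add: eqs field_simps)
qed

lemma
  assumes F: "F differentiable at p"
  shows frame_deriv_minus: "frame_deriv A (\<lambda>q. - F q) p = - frame_deriv A F p"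
    and frame_deriv_divide: "frame_deriv A (\<lambda>q. F q / c) p = frame_deriv A F p / c"
  using frame_deriv_mult[OF differentiable_const[of "- 1"] F, of A]
    frame_deriv_mult[OF differentiable_const[of "inverse c"] F, of A]
  by (simp_all add: divide_inverse mult.commute)

lemma frame_deriv_diff:
  assumes "F differentiable at p" "G differentiable at p"
  shows "frame_deriv A (\<lambda>q. F q - G q) p = frame_deriv A F p - frame_deriv A G p"
  using frame_deriv_add[OF assms(1) differentiable_minus[OF assms(2)], of A]
  by (simp add: frame_deriv_minus assms)

lemma differentiable_cdivide:
  fixes F :: "'a::real_normed_vector \<Rightarrow> complex"
  assumes "F differentiable at p"
  shows "(\<lambda>q. F q / c) differentiable at p"
  using differentiable_mult[OF assms differentiable_const[of "inverse c"]] by (simp add: divide_inverse)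

lemma has_derivative_cexp:
  fixes F :: "'a::real_normed_vector \<Rightarrow> complex"
  assumes "(F has_derivative F') (at p)"
  shows "((\<lambda>q. exp (F q)) has_derivative (\<lambda>v. exp (F p) * F' v)) (at p)"
  using has_derivative_compose[OF assms DERIV_exp[unfolded has_field_derivative_def]] .

lemma frame_deriv_exp:
  assumes "F differentiable at p"
  shows "frame_deriv A (\<lambda>q. exp (F q)) p = exp (F p) * frame_deriv A F p"
proof -
  obtain F' where d: "(F has_derivative F') (at p)"
    using assms by (auto simp: differentiable_def)
  show ?thesis
    by (cases A) (simp_all add: wirtinger_eq[OF d] wirtinger_eq[OF has_derivative_cexp[OF d]] field_simps)
qed

text \<open>Conjugation commutes with the real derivative and turns \<open>\<i>\<close> into
  \<open>- \<i>\<close>. This carries holomorphic identities over to the antiholomorphic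
  side.\<close>

lemma wirtinger_bar_eq_cnj:
  assumes "F differentiable at p"
  shows "wirtinger_bar j F p = cnj (wirtinger j (\<lambda>q. cnj (F q)) p)"
proof -
  obtain F' where d: "(F has_derivative F') (at p)"
    using assms by (auto simp: differentiable_def)
  show ?thesis
    by (simp add: wirtinger_eq[OF d] wirtinger_eq[OF has_derivative_cnj[OF d]])
qed

lemma bounded_linear_frame_deriv:
  assumes "bounded_linear L"
  shows "frame_deriv (Inl j) L p = (L (axis j 1) - \<i> * L (axis j \<i>)) / 2"
    and "frame_deriv (Inr j) L p = (L (axis j 1) + \<i> * L (axis j \<i>)) / 2"
  using wirtinger_eq[OF bounded_linear_imp_has_derivative[OF assms]] by simp_all

lemma bounded_linear_coord:
  "bounded_linear (\<lambda>q::complex^'n. q $ k)"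
  "bounded_linear (\<lambda>q::complex^'n. cnj (q $ k))"
  "bounded_linear (\<lambda>q::complex^'n. complex_of_real (Re (q $ k)))"
  by (rule bounded_linear_vec_nth
    bounded_linear_compose[OF bounded_linear_cnj bounded_linear_vec_nth]
    bounded_linear_compose[OF bounded_linear_of_real]
    bounded_linear_compose[OF bounded_linear_Re bounded_linear_vec_nth])+

lemmas differentiable_coord = bounded_linear_coord[THEN bounded_linear_imp_differentiable]

text \<open>The value \<open>1 / 2\<close> comes from the real part being half the sum of the
  coordinate and its conjugate.\<close>

lemma frame_deriv_coord:
  fixes p :: "complex^'n::finite"
  shows "frame_deriv A (\<lambda>q. q $ k) p = (if A = Inl k then 1 else 0)"
    and "frame_deriv A (\<lambda>q. cnj (q $ k)) p = (if A = Inr k then 1 else 0)"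
    and "frame_deriv A (\<lambda>q. complex_of_real (Re (q $ k))) p =
      (if A = Inl k \<or> A = Inr k then 1 / 2 else 0)"
  by (cases A; auto simp: bounded_linear_frame_deriv bounded_linear_coord axis_def simp del: frame_deriv.simps)+

lemma differentiable_cexp:
  fixes F :: "'a::real_normed_vector \<Rightarrow> complex"
  assumes "F differentiable at p"
  shows "(\<lambda>q. exp (F q)) differentiable at p"
  using assms has_derivative_cexp unfolding differentiable_def by blast

lemmas frame_deriv_rules = frame_deriv_add frame_deriv_diff frame_deriv_minus frame_deriv_divide
  frame_deriv_mult frame_deriv_exp frame_deriv_coord
  differentiable_coord differentiable_cexp differentiable_cdivide

section \<open>Smooth functions\<close>

text \<open>Serves \<open>C_k_mult\<close>: in the product rule one factor stays undifferentiated
  and has to be lowered from order \<open>Suc k\<close> to \<open>k\<close>.\<close>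

lemma C_k_Suc_imp: "C_k (Suc k) F \<Longrightarrow> C_k k F"
proof (induction k arbitrary: F)
  case 0
  then show ?case
    by (auto intro!: differentiable_imp_continuous_on simp: differentiable_on_def differentiable_at_withinI)
next
  case (Suc k)
  then show ?case using C_k.simps(2) by blast
qed

lemma C_k_const: "C_k k (\<lambda>x. c)"
  by (induction k arbitrary: c) auto

lemma C_k_bounded_linear:
  assumes "bounded_linear L"
  shows "C_k k L"
proof (cases k)
  case 0
  then show ?thesis
    using assms by (simp add: linear_continuous_on)
next
  case (Suc m)
  have "frechet_derivative L (at x) = L" for x
    using frechet_derivative_at[OF bounded_linear_imp_has_derivative[OF assms]] by metis
  then show ?thesis
    using assms Suc by (simp add: C_k_const bounded_linear_imp_differentiable)
qed

lemma C_k_add: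
  assumes "C_k k F" "C_k k G"
  shows "C_k k (\<lambda>x. F x + G x)"
  using assms
proof (induction k arbitrary: F G)
  case 0
  then show ?case by (simp add: continuous_on_add)
next
  case (Suc k)
  have "frechet_derivative (\<lambda>x. F x + G x) (at x) =
      (\<lambda>v. frechet_derivative F (at x) v + frechet_derivative G (at x) v)" for x
    using Suc.prems
    by (intro frechet_derivative_at[symmetric] has_derivative_add)
      (simp_all add: frechet_derivative_works)
  with Suc show ?case by (simp add: differentiable_add)
qed

lemma C_k_mult:
  fixes F G :: "'a::real_normed_vector \<Rightarrow> 'b::real_normed_algebra"
  assumes "C_k k F" "C_k k G"
  shows "C_k k (\<lambda>x. F x * G x)"
  using assms
proof (induction k arbitrary: F G)
  case 0
  then show ?case by (simp add: continuous_on_mult)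
next
  case (Suc k)
  have "frechet_derivative (\<lambda>x. F x * G x) (at x) =
      (\<lambda>v. F x * frechet_derivative G (at x) v + frechet_derivative F (at x) v * G x)" for x
    using Suc.prems
    by (intro frechet_derivative_at[symmetric] has_derivative_mult)
      (simp_all add: frechet_derivative_works)
  with Suc show ?case
    by (simp add: differentiable_mult C_k_add C_k_Suc_imp)
qed

text \<open>The derivative of \<open>exp (L x)\<close> in direction \<open>v\<close> is the same
  function times the constant \<open>L v\<close>, so the induction closes.\<close>

lemma C_k_exp_bounded_linear:
  fixes L :: "'a::real_normed_vector \<Rightarrow> complex"
  assumes L: "bounded_linear L"
  shows "C_k k (\<lambda>x. exp (L x))"
proof (induction k)
  case 0
  then show ?case
    using L by (simp add: continuous_on_exp linear_continuous_on)
next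
  case (Suc k)
  have d: "((\<lambda>x. exp (L x)) has_derivative (\<lambda>v. exp (L x) * L v)) (at x)" for x
    by (intro has_derivative_cexp bounded_linear_imp_has_derivative L)
  show ?case
    using Suc by (simp add: frechet_derivative_at[OF d, symmetric] differentiableI[OF d] C_k_mult C_k_const)
qed

section \<open>The Levi-Civita connection of a Kaehler metric\<close>

lemma frame_matrix_nth: "frame_matrix h $ A $ B = frame_coeff h A B"
  by (simp add: frame_matrix_def)

text \<open>\<open>matrix_inv\<close> chooses a two-sided inverse; over a field a right inverse of a
  square matrix is two-sided, hence the only candidate.\<close>

lemma matrix_inv_unique:
  fixes A :: "'a::field^'n^'n"
  assumes "A ** B = mat 1"
  shows "matrix_inv A = B"
proof -
  have "B ** A = mat 1" using assms matrix_left_right_inverse by blast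
  then have "A ** matrix_inv A = mat 1"
    using someI[of "\<lambda>A'. A ** A' = mat 1 \<and> A' ** A = mat 1" B] assms by (simp add: matrix_inv_def)
  then show ?thesis
    by (metis \<open>B ** A = mat 1\<close> matrix_mul_assoc matrix_mul_lid matrix_mul_rid)
qed

lemma sum_UNIV_Plus:
  fixes h :: "'a::finite + 'b::finite \<Rightarrow> 'c::comm_monoid_add"
  shows "sum h UNIV = (\<Sum>a\<in>UNIV. h (Inl a)) + (\<Sum>b\<in>UNIV. h (Inr b))"
  by (simp add: UNIV_Plus_UNIV[symmetric] sum.Plus del: UNIV_Plus_UNIV)

text \<open>In block form \<open>frame_matrix h\<close> is \<open>[[0, h], [h\<^sup>T, 0]]\<close>.\<close>

lemma matrix_inv_frame_matrix:
  assumes "h ** K = mat 1"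
  shows "matrix_inv (frame_matrix h) = frame_matrix (transpose K)"
proof (rule matrix_inv_unique)
  have "(\<Sum>c\<in>UNIV. h $ a $ c * K $ c $ b) = (if a = b then 1 else 0)" for a b
    using arg_cong[OF assms, of "\<lambda>M. M $ a $ b"] by (simp add: matrix_matrix_mult_def mat_def)
  \<comment> \<open>The diagonal blocks of the product are \<open>h ** K\<close> and the transpose
    of \<open>K ** h\<close>, so both orders are needed.\<close>
  moreover have "K ** h = mat 1" using assms matrix_left_right_inverse by blast
  then have "(\<Sum>c\<in>UNIV. h $ c $ a * K $ b $ c) = (if a = b then 1 else 0)" for a b
    by (auto simp: vec_eq_iff matrix_matrix_mult_def mat_def mult.commute)
  ultimately have "(\<Sum>E\<in>UNIV. frame_coeff h A E * frame_coeff (transpose K) E B) = (if A = B then 1 else 0)"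
    for A B
    by (cases A; cases B) (simp_all add: sum_UNIV_Plus transpose_def)
  then show "frame_matrix h ** frame_matrix (transpose K) = mat 1"
    by (simp add: frame_matrix_nth matrix_matrix_mult_def mat_def vec_eq_iff)
qed

lemma kahler_metric_differentiable:
  assumes "kahler_metric g"
  shows "(\<lambda>q. g q $ a $ b) differentiable at p"
proof -
  have "C_k (Suc 0) (\<lambda>q. g q $ a $ b)"
    using assms unfolding kahler_metric_def smooth_def by blast
  then show ?thesis by (simp only: C_k.simps)
qed

lemma kahler_metric_wirtinger:
  assumes "kahler_metric g"
  shows "wirtinger a (\<lambda>q. g q $ b $ c) p = wirtinger b (\<lambda>q. g q $ a $ c) p"
    and "wirtinger_bar a (\<lambda>q. g q $ c $ b) p = wirtinger_bar b (\<lambda>q. g q $ c $ a) p"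
proof -
  show *: "wirtinger a (\<lambda>q. g q $ b $ c) p = wirtinger b (\<lambda>q. g q $ a $ c) p" for a b
    using assms unfolding kahler_metric_def by blast
  have herm: "g q $ e $ d = cnj (g q $ d $ e)" for q d e
    using assms unfolding kahler_metric_def by blast
  show "wirtinger_bar a (\<lambda>q. g q $ c $ b) p = wirtinger_bar b (\<lambda>q. g q $ c $ a) p"
    by (simp only: wirtinger_bar_eq_cnj kahler_metric_differentiable[OF assms] herm[symmetric] *)
qed

text \<open>The inverse frame matrix pairs only opposite types, so an upper index
  \<open>Inl d\<close> leaves only \<open>E = Inr c\<close> in the Koszul sum. If all types agree,
  closedness makes the first two terms equal, which cancels the factor \<open>1 / 2\<close>. If the
  lower types differ, closedness cancels the two remaining terms; if both are opposite to the upper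
  one, every term is zero.\<close>

lemma christoffel_kahler:
  assumes g: "kahler_metric g" and K: "g p ** K = mat 1"
  shows "christoffel g (Inl d) (Inl a) (Inl b) p =
      (\<Sum>c\<in>UNIV. wirtinger a (\<lambda>q. g q $ b $ c) p * K $ c $ d)"
    and "christoffel g (Inr d) (Inr a) (Inr b) p =
      (\<Sum>c\<in>UNIV. wirtinger_bar a (\<lambda>q. g q $ c $ b) p * K $ d $ c)"
    and "christoffel g (Inl d) (Inr a) B p = 0"
    and "christoffel g (Inl d) A (Inr b) p = 0"
    and "christoffel g (Inr d) (Inl a) B p = 0"
    and "christoffel g (Inr d) A (Inl b) p = 0"
proof -
  note [simp] = christoffel_def matrix_inv_frame_matrix[OF K] sum_UNIV_Plus frame_matrix_nth transpose_def
  note w = kahler_metric_wirtinger[OF g]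
  have c0: "wirtinger a (\<lambda>q. c) p = 0" "wirtinger_bar a (\<lambda>q. c) p = 0" for a c
    using frame_deriv_const[of "Inl a"] frame_deriv_const[of "Inr a"] by auto
  show "christoffel g (Inl d) (Inl a) (Inl b) p =
      (\<Sum>c\<in>UNIV. wirtinger a (\<lambda>q. g q $ b $ c) p * K $ c $ d)"
    by (simp add: c0 w(1)[of b a] sum_distrib_left[symmetric] sum_distrib_right mult.assoc flip: mult_2)
  show "christoffel g (Inr d) (Inr a) (Inr b) p =
      (\<Sum>c\<in>UNIV. wirtinger_bar a (\<lambda>q. g q $ c $ b) p * K $ d $ c)"
    by (simp add: c0 w(2)[of b _ a] sum_distrib_left[symmetric] sum_distrib_right mult.assoc flip: mult_2)
  show "christoffel g (Inl d) (Inr a) B p = 0"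
    by (cases B) (auto simp: c0 intro!: sum.neutral w)
  show "christoffel g (Inl d) A (Inr b) p = 0"
    by (cases A) (auto simp: c0 intro!: sum.neutral w)
  show "christoffel g (Inr d) (Inl a) B p = 0"
    by (cases B) (auto simp: c0 intro!: sum.neutral w)
  show "christoffel g (Inr d) A (Inl b) p = 0"
    by (cases A) (auto simp: c0 intro!: sum.neutral w)
qed

section \<open>Warren's metric\<close>

text \<open>The squared modulus of \<open>z\<close> is written as
  \<open>p $ 1 * cnj (p $ 1)\<close>, so that the product and coordinate rules apply to it.\<close>

definition warren_metric :: "complex^2 \<Rightarrow> complex^2^2" where
  "warren_metric p = (let u = complex_of_real (Re (p $ 2)) in
     vector [vector [4 * exp u, 2 * cnj (p $ 1) * exp u],
       vector [2 * p $ 1 * exp u, p $ 1 * cnj (p $ 1) * exp u + 1 / 4 * exp (- u)]])"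

lemma warren_metric_component:
  "warren_metric p $ 1 $ 1 = 4 * exp (complex_of_real (Re (p $ 2)))"
  "warren_metric p $ 1 $ 2 = 2 * cnj (p $ 1) * exp (complex_of_real (Re (p $ 2)))"
  "warren_metric p $ 2 $ 1 = 2 * p $ 1 * exp (complex_of_real (Re (p $ 2)))"
  "warren_metric p $ 2 $ 2 = p $ 1 * cnj (p $ 1) * exp (complex_of_real (Re (p $ 2)))
     + exp (- complex_of_real (Re (p $ 2))) / 4"
  by (simp_all add: warren_metric_def Let_def)

section \<open>The potential, smoothness and positivity\<close>

lemma potential_metric_warren:
  assumes f: "\<And>p. f p = 4 * (cmod (p $ 1))\<^sup>2 * exp (Re (p $ 2)) + exp (- Re (p $ 2))"
  shows "potential_metric f = warren_metric"
proof
  fix p :: "complex^2"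
  let ?e = "\<lambda>q::complex^2. exp (complex_of_real (Re (q $ 2)))"
  let ?e' = "\<lambda>q::complex^2. exp (- complex_of_real (Re (q $ 2)))"
  have f': "(\<lambda>q. complex_of_real (f q)) = (\<lambda>q. 4 * (q $ 1 * cnj (q $ 1)) * ?e q + ?e' q)"
    by (simp add: f complex_norm_square[symmetric] exp_of_real flip: of_real_minus)
  \<comment> \<open>An equation between functions, since the result is differentiated once more. For
    \<open>b = 2\<close> the derivative is half the one in \<open>u\<close>.\<close>
  have "frame_deriv (Inr b) (\<lambda>q. complex_of_real (f q)) =
      (\<lambda>q. if b = 1 then 4 * q $ 1 * ?e q else 2 * (q $ 1 * cnj (q $ 1)) * ?e q - ?e' q / 2)" for b
    unfolding f' using exhaust_2[of b]
    by (auto simp: fun_eq_iff frame_deriv_rules simp del: frame_deriv.simps)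
  then have "frame_deriv (Inl a) (frame_deriv (Inr b) (\<lambda>q. complex_of_real (f q))) p = warren_metric p $ a $ b"
    for a b :: 2
    using exhaust_2[of a] exhaust_2[of b]
    by (auto simp: frame_deriv_rules warren_metric_component simp del: frame_deriv.simps)
  then show "potential_metric f p = warren_metric p"
    by (simp add: potential_metric_def vec_eq_iff)
qed

lemma smooth_warren_metric: "smooth (\<lambda>p. warren_metric p $ a $ b)"
proof -
  have L: "bounded_linear (\<lambda>q::complex^2. - complex_of_real (Re (q $ 2)))"
    by (intro bounded_linear_minus bounded_linear_coord)
  have "C_k k (\<lambda>q::complex^2. q $ 1)" "C_k k (\<lambda>q::complex^2. cnj (q $ 1))"
    "C_k k (\<lambda>q::complex^2. exp (complex_of_real (Re (q $ 2))))"
    "C_k k (\<lambda>q::complex^2. exp (- complex_of_real (Re (q $ 2))))" for k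
    by (rule C_k_bounded_linear C_k_exp_bounded_linear bounded_linear_coord L)+
  then show ?thesis
    unfolding smooth_def using exhaust_2[of a] exhaust_2[of b]
    by (auto simp only: warren_metric_component divide_inverse intro!: C_k_add C_k_mult C_k_const)
qed

text \<open>Positivity is the completion of the square
  \<open>g(v, v) = e\<^sup>u |2 v\<^sub>1 + z v\<^sub>2|\<^sup>2 + e\<^sup>-\<^sup>u |v\<^sub>2|\<^sup>2 / 4\<close>.\<close>

lemma warren_metric_pos:
  assumes "v \<noteq> 0"
  shows "0 < Re (\<Sum>a\<in>UNIV. \<Sum>b\<in>UNIV. warren_metric p $ a $ b * v $ a * cnj (v $ b))"
proof -
  define e where "e = exp (Re (p $ 2))"
  define e' where "e' = exp (- Re (p $ 2))"
  have pos: "e > 0" "e' > 0" by (simp_all add: e_def e'_def)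
  have [simp]: "exp (complex_of_real (Re (p $ 2))) = of_real e"
    "exp (- complex_of_real (Re (p $ 2))) = of_real e'"
    by (simp_all add: e_def e'_def exp_of_real flip: of_real_minus)
  have "(\<Sum>a\<in>UNIV. \<Sum>b\<in>UNIV. warren_metric p $ a $ b * v $ a * cnj (v $ b)) =
      e * ((2 * v $ 1 + p $ 1 * v $ 2) * cnj (2 * v $ 1 + p $ 1 * v $ 2)) + e' / 4 * (v $ 2 * cnj (v $ 2))"
    by (simp add: sum_2 warren_metric_component algebra_simps)
  also have "\<dots> = complex_of_real (e * (cmod (2 * v $ 1 + p $ 1 * v $ 2))\<^sup>2 + e' / 4 * (cmod (v $ 2))\<^sup>2)"
    by (simp only: complex_norm_square[symmetric]) simp
  finally have eq: "Re (\<Sum>a\<in>UNIV. \<Sum>b\<in>UNIV. warren_metric p $ a $ b * v $ a * cnj (v $ b)) =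
      e * (cmod (2 * v $ 1 + p $ 1 * v $ 2))\<^sup>2 + e' / 4 * (cmod (v $ 2))\<^sup>2"
    by (simp only: Re_complex_of_real)
  show ?thesis
  proof (cases "v $ 2 = 0")
    case True
    then have "v $ 1 \<noteq> 0" using assms by (auto simp: vec_eq_iff forall_2)
    then show ?thesis using True pos unfolding eq by simp
  next
    case False
    then show ?thesis using pos unfolding eq by (intro add_nonneg_pos) auto
  qed
qed

text \<open>Since \<open>w\<close> enters only through its real part, its two Wirtinger derivatives
  agree; the last branch of the fourth formula serves both \<open>Inl 2\<close> and
  \<open>Inr 2\<close>.\<close>

lemma frame_deriv_warren_metric:
  "frame_deriv A (\<lambda>q. warren_metric q $ 1 $ 1) p =
    2 * exp (complex_of_real (Re (p $ 2))) * (if A = Inl 2 \<or> A = Inr 2 then 1 else 0)" (is ?P1)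
  "frame_deriv A (\<lambda>q. warren_metric q $ 1 $ 2) p = exp (complex_of_real (Re (p $ 2))) *
    (if A = Inr 1 then 2 else if A = Inl 2 \<or> A = Inr 2 then cnj (p $ 1) else 0)" (is ?P2)
  "frame_deriv A (\<lambda>q. warren_metric q $ 2 $ 1) p = exp (complex_of_real (Re (p $ 2))) *
    (if A = Inl 1 then 2 else if A = Inl 2 \<or> A = Inr 2 then p $ 1 else 0)" (is ?P3)
  "frame_deriv A (\<lambda>q. warren_metric q $ 2 $ 2) p =
    (if A = Inl 1 then cnj (p $ 1) * exp (complex_of_real (Re (p $ 2)))
     else if A = Inr 1 then p $ 1 * exp (complex_of_real (Re (p $ 2)))
     else p $ 1 * cnj (p $ 1) * exp (complex_of_real (Re (p $ 2))) / 2
       - exp (- complex_of_real (Re (p $ 2))) / 8)" (is ?P4)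
proof -
  have "A = Inl 1 \<or> A = Inl 2 \<or> A = Inr 1 \<or> A = Inr 2"
    using exhaust_2 by (cases A) auto
  then show ?P1 ?P2 ?P3 ?P4
    by (auto simp: frame_deriv_rules warren_metric_component simp del: frame_deriv.simps)
qed

lemmas wirtinger_warren_metric =
  frame_deriv_warren_metric[of "Inl _", unfolded frame_deriv.simps]
  frame_deriv_warren_metric[of "Inr _", unfolded frame_deriv.simps]

lemma kahler_warren_metric: "kahler_metric warren_metric"
proof -
  have "warren_metric p $ b $ a = cnj (warren_metric p $ a $ b)" for p a b
    using exhaust_2[of a] exhaust_2[of b]
    by (auto simp: warren_metric_component exp_cnj)
  \<comment> \<open>Only distinct \<open>a\<close>, \<open>b\<close> matter: both sides are then
    \<open>2 * exp u\<close> for \<open>c = 1\<close> and \<open>cnj z * exp u\<close> for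
    \<open>c = 2\<close>.\<close>
  moreover have "wirtinger a (\<lambda>q. warren_metric q $ b $ c) p = wirtinger b (\<lambda>q. warren_metric q $ a $ c) p"
    for p a b c
    using exhaust_2[of a] exhaust_2[of b] exhaust_2[of c]
    by (auto simp: wirtinger_warren_metric)
  ultimately show ?thesis
    using smooth_warren_metric warren_metric_pos unfolding kahler_metric_def by blast
qed

section \<open>The inverse matrix, the connection and the curvature\<close>

definition warren_inverse :: "complex^2 \<Rightarrow> complex^2^2" where
  "warren_inverse p = (\<chi> a b. if a = b then warren_metric p $ (3 - a) $ (3 - a)
     else - warren_metric p $ a $ b)"

text \<open>In the determinant the terms with \<open>exp (2 * u)\<close> cancel and
  \<open>4 * exp u * exp (- u) / 4 = 1\<close> remains, so the adjugate is the inverse. The index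
  \<open>3 - a\<close> is the other element of type \<open>2\<close>.\<close>

lemma warren_inverse: "warren_metric p ** warren_inverse p = mat 1"
  by (simp add: vec_eq_iff forall_2 matrix_matrix_mult_def sum_2 mat_def warren_inverse_def
    warren_metric_component algebra_simps flip: exp_add)

lemma warren_inverse_component:
  "warren_inverse p $ 1 $ 1 = warren_metric p $ 2 $ 2"
  "warren_inverse p $ 1 $ 2 = - warren_metric p $ 1 $ 2"
  "warren_inverse p $ 2 $ 1 = - warren_metric p $ 2 $ 1"
  "warren_inverse p $ 2 $ 2 = warren_metric p $ 1 $ 1"
  by (simp_all add: warren_inverse_def)

text \<open>The argument \<open>z\<close> is free so that one table serves the holomorphic symbols
  at \<open>p $ 1\<close> and the antiholomorphic ones at \<open>cnj (p $ 1)\<close>.\<close>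

definition warren_symbol :: "complex \<Rightarrow> 2 \<Rightarrow> 2 \<Rightarrow> 2 \<Rightarrow> complex" where
  "warren_symbol z d a b =
     (if d = 1 then if a \<noteq> b then 1 / 2 else if a = 2 then z / 2 else 0
      else if a = 2 \<and> b = 2 then - 1 / 2 else 0)"

text \<open>Equations between functions rather than values at a point, because the curvature
  differentiates the symbols.\<close>

lemma christoffel_warren:
  "christoffel warren_metric (Inl d) (Inl a) (Inl b) = (\<lambda>p. warren_symbol (p $ 1) d a b)" (is ?L)
  "christoffel warren_metric (Inr d) (Inr a) (Inr b) = (\<lambda>p. warren_symbol (cnj (p $ 1)) d a b)" (is ?R)
  "christoffel warren_metric (Inl d) (Inr a) B = (\<lambda>p. 0)"
  "christoffel warren_metric (Inl d) A (Inr b) = (\<lambda>p. 0)"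
  "christoffel warren_metric (Inr d) (Inl a) B = (\<lambda>p. 0)"
  "christoffel warren_metric (Inr d) A (Inl b) = (\<lambda>p. 0)"
proof -
  note ck = christoffel_kahler[OF kahler_warren_metric warren_inverse]
  show ?L ?R
    using exhaust_2[of d] exhaust_2[of a] exhaust_2[of b]
    by (elim disjE; simp only: fun_eq_iff ck sum_2 wirtinger_warren_metric warren_inverse_component;
        simp add: warren_metric_component warren_symbol_def algebra_simps flip: exp_add)+
qed (simp_all add: fun_eq_iff christoffel_kahler[OF kahler_warren_metric warren_inverse])

lemma flat_warren_metric: "flat_metric warren_metric"
proof -
  have d: "frame_deriv A (\<lambda>q. q $ 1 / 2) p = (if A = Inl 1 then 1 / 2 else 0)"
    "frame_deriv A (\<lambda>q. cnj (q $ 1) / 2) p = (if A = Inr 1 then 1 / 2 else 0)"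
    for A and p :: "complex^2"
    by (simp_all add: frame_deriv_divide frame_deriv_coord differentiable_coord)
  \<comment> \<open>Up to conjugation and antisymmetry, the one cancellation between nonzero terms
    has upper index \<open>z\<close> and lower indices \<open>z\<close>, \<open>w\<close>,
    \<open>w\<close>: the derivative of \<open>z / 2\<close> gives \<open>1 / 2\<close>, and the two
    products of symbols contribute \<open>- 1 / 4\<close> each.\<close>
  show ?thesis
    by (simp add: flat_metric_def split_sum_all forall_2 curvature_def sum_UNIV_Plus sum_2
      christoffel_warren d warren_symbol_def del: frame_deriv.simps)
qed

theorem theorem1:
  fixes f :: "complex^2 \<Rightarrow> real" and g :: "complex^2 \<Rightarrow> complex^2^2"
  assumes f: "\<And>p. f p = 4 * (cmod (p $ 1))\<^sup>2 * exp (Re (p $ 2)) + exp (- Re (p $ 2))"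
    and g: "g = potential_metric f"
  shows "kahler_metric g \<and>
    (\<forall>p. let z = p $ 1; w = p $ 2; u = complex_of_real (Re w) in
       g p = vector [vector [4 * exp u,         2 * cnj z * exp u],
                     vector [2 * z * exp u,     (complex_of_real (cmod z))\<^sup>2 * exp u + 1 / 4 * exp (- u)]]) \<and>
    flat_metric g"
proof -
  have "g = warren_metric" using g potential_metric_warren[OF f] by simp
  then show ?thesis
    using kahler_warren_metric flat_warren_metric
    by (simp add: warren_metric_def Let_def complex_norm_square[symmetric])
qed

end
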